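(* Let $X$ be a manifold homotopically stratified space (MHSS), $Y$ a pure subset of $X$, and $N$ an approximate tubular neighborhood of $Y$ in $X$. Then $N$ is a nearly stratum-preserving deformation retract neighborhood (NSDRN) of $Y$.
   Context: A filtered space is a space $X$ with a finite filtration $X=X^n\supset X^{n-1}\supset\cdots\supset X^0\supset X^{-1}=\emptyset$; $X_i=X^i-X^{i-1}$ is the $i$th stratum. Subspaces carry the restricted filtration, and $Y\times\mathbb{R}$ has strata $Y_i\times\mathbb{R}$. A map $f:Z\times A\to X$ to a filtered space is stratum-preserving along $A$ if $f(\{z\}\times A)$ lies in a single stratum for each $z$; for $A=I=[0,1]$ it is a stratum-preserving homotopy, and a homotopy is nearly stratum-preserving if its restriction to $Z\times[0,1)$ is stratum-preserving along $[0,1)$. MHSS. A subspace $Y$ of $X$ is forward tame in $X$ if there is a neighborhood $U$ of $Y$ and a nearly stratum-preserving deformation retraction $U\times I\to X$ of $U$ to $Y$ rel $Y$ (ending in $Y$ at time $1$). $\mathrm{holink}_s(X,Y)$ is the space (compact-open topology) of paths $\omega:I\to X$ with $\omega(0)\in Y$ and $\omega((0,1])$ contained in a single stratum of $X$ and in $X-Y$, stratified by the stratum containing $\omega(1)$; holink evaluation is $\omega\mapsto\omega(0)$. For $x\in X_i$, $\mathrm{holink}_s(X,x)\subset\mathrm{holink}_s(X,X_i)$ consists of paths with $\omega(0)=x$. $X$ is an MHSS if: $X$ is locally compact, separable and metric; it has finitely many strata and each $X_i$ is an $i$-manifold without boundary, locally closed in $X$; for each $k>i$, $X_i$ is forward tame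 in $X_i\cup X_k$; for each $k>i$, the evaluation $\mathrm{holink}_s(X_i\cup X_k,X_i)\to X_i$ is a fibration; and for each $x$ there is a stratum-preserving homotopy $\mathrm{holink}_s(X,x)\times I\to\mathrm{holink}_s(X,x)$ from the identity to a map into a compact subset. A pure subset is a closed subspace that is a union of components of strata. NSDRN. A neighborhood $N$ of $Y$ is an NSDRN if there is a strong deformation retraction $r:N\times I\to N$ of $N$ to $Y$ (rel $Y$, with $r_0=\mathrm{id}$, $r_1(N)=Y$) that is stratum-preserving on $N\times[0,1)$. Approximate tubular neighborhoods. A manifold stratified approximate fibration (MSAF) is a proper map $q:A\to B$ between MHSSs such that for every space $Z$, map $f:Z\to A$ and stratum-preserving homotopy $F:Z\times I\to B$ with $F(z,0)=qf(z)$, there is a map $\tilde F:Z\times I\times[0,1)\to A$, stratum-preserving along $I\times[0,1)$, with $\tilde F(z,0,t)=f(z)$, such that $\bar F:Z\times I\times I\to B$ defined by $\bar F|_{Z\times I\times[0,1)}=q\tilde F$ and $\bar F|_{Z\times I\times\{1\}}=F$ is continuous. For a map $p:W\to Y\times\mathbb{R}$, the teardrop $W\cup_pY$ is the set $W\amalg Y$ with the minimal topology such that $W\hookrightarrow W\cup_pY$ is an open embedding and the function $c:W\cup_pY\to Y\times(-\infty,\infty]$, $c(x)=p(x)$ for $x\in W$, $c(y)=(y,\infty)$ for $y\in Y$, is continuous. A neighborhood $N$ of the pure subset $Y$ in $X$ is an approximate tubular neighborhood if there is an MSAF $p:N-Y\to Y\times\mathbb{R}$ such that the teardrop $(N-Y)\cup_pY$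 is homeomorphic to $N$ (via the natural identification of underlying sets). *)

theory Defs
  imports "HOL-Analysis.Analysis"
begin

section \<open>Filtered spaces\<close>

text \<open>
  A filtered space is a topology \<open>X\<close> together with a filtration \<open>F\<close>, where \<open>F i\<close> is the skeleton
  \<open>X\<^sup>i\<close>. The index is an integer, with \<open>F i = {}\<close> for \<open>i < 0\<close>.
\<close>

definition filtered_space :: "'a topology \<Rightarrow> (int \<Rightarrow> 'a set) \<Rightarrow> bool" where
  "filtered_space X F \<longleftrightarrow>
     mono F \<and> (\<forall>i<0. F i = {}) \<and> (\<exists>n. \<forall>i\<ge>n. F i = topspace X)"

definition stratum :: "(int \<Rightarrow> 'a set) \<Rightarrow> int \<Rightarrow> 'a set" where
  "stratum F i = F i - F (i - 1)"

definition restrict_filtration :: "(int \<Rightarrow> 'a set) \<Rightarrow> 'a set \<Rightarrow> int \<Rightarrow> 'a set" where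
  "restrict_filtration F S i = F i \<inter> S"

text \<open>
  The strata of \<open>Y \<times> \<real>\<close> are the sets \<open>Y\<^sub>i \<times> \<real>\<close>. The index is shifted by one, so that
  \<open>Y\<^sub>i \<times> \<real>\<close> is the stratum of index \<open>i + 1\<close>, its dimension when \<open>Y\<^sub>i\<close> is an \<open>i\<close>-manifold.
\<close>

definition times_real_filtration :: "(int \<Rightarrow> 'a set) \<Rightarrow> int \<Rightarrow> ('a \<times> real) set" where
  "times_real_filtration F i = F (i - 1) \<times> UNIV"

lemma stratum_restrict_filtration: "stratum (restrict_filtration F S) i = stratum F i \<inter> S"
  by (auto simp: stratum_def restrict_filtration_def)

lemma stratum_times_real_filtration:
  "stratum (times_real_filtration F) (i + 1) = stratum F i \<times> UNIV"
  by (auto simp: stratum_def times_real_filtration_def)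

abbreviation unit_interval :: "real topology" where
  "unit_interval \<equiv> top_of_set {0..1}"

definition stratum_preserving_along ::
  "(int \<Rightarrow> 'b set) \<Rightarrow> 'z set \<Rightarrow> 'a set \<Rightarrow> ('z \<times> 'a \<Rightarrow> 'b) \<Rightarrow> bool" where
  "stratum_preserving_along F Z A f \<longleftrightarrow> (\<forall>z\<in>Z. \<exists>i. f ` ({z} \<times> A) \<subseteq> stratum F i)"

definition neighborhood :: "'a topology \<Rightarrow> 'a set \<Rightarrow> 'a set \<Rightarrow> bool" where
  "neighborhood X N Y \<longleftrightarrow> N \<subseteq> topspace X \<and> (\<exists>U. openin X U \<and> Y \<subseteq> U \<and> U \<subseteq> N)"

section \<open>Forward tameness and homotopy links\<close>

definition forward_tame :: "'a topology \<Rightarrow> (int \<Rightarrow> 'a set) \<Rightarrow> 'a set \<Rightarrow> bool" where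
  "forward_tame X F Y \<longleftrightarrow>
     (\<exists>U h. neighborhood X U Y \<and>
        continuous_map (prod_topology (subtopology X U) unit_interval) X h \<and>
        (\<forall>u\<in>U. h (u, 0) = u) \<and>
        (\<forall>y\<in>Y. \<forall>t\<in>{0..1}. h (y, t) = y) \<and>
        (\<forall>u\<in>U. h (u, 1) \<in> Y) \<and>
        stratum_preserving_along F U {0..<1} h)"

text \<open>
  Maps are represented extensionally, so that distinct elements of the mapping space are
  distinct as maps on \<open>topspace A\<close>.
\<close>

definition compact_open :: "'a topology \<Rightarrow> 'b topology \<Rightarrow> ('a \<Rightarrow> 'b) topology" where
  "compact_open A X =
     topology_generated_by
       {{f \<in> extensional (topspace A). continuous_map A X f \<and> f ` K \<subseteq> U} | K U.
          compactin A K \<and> openin X U}"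

lemma topspace_compact_open:
  "topspace (compact_open A X) = {f \<in> extensional (topspace A). continuous_map A X f}"
proof -
  let ?S = "{f \<in> extensional (topspace A). continuous_map A X f \<and> f ` {} \<subseteq> topspace X}"
  have "?S \<in> {{f \<in> extensional (topspace A). continuous_map A X f \<and> f ` K \<subseteq> U} | K U.
      compactin A K \<and> openin X U}"
    using compactin_empty openin_topspace by blast
  then have "?S \<subseteq> topspace (compact_open A X)"
    unfolding compact_open_def topology_generated_by_topspace by (rule Union_upper)
  moreover have "topspace (compact_open A X) \<subseteq> ?S"
    unfolding compact_open_def topology_generated_by_topspace by auto
  ultimately show ?thesis
    by auto
qed

definition holink_s :: "'a topology \<Rightarrow> (int \<Rightarrow> 'a set) \<Rightarrow> 'a set \<Rightarrow> (real \<Rightarrow> 'a) set" where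
  "holink_s X F Y =
     {\<omega> \<in> topspace (compact_open unit_interval X).
        \<omega> 0 \<in> Y \<and> (\<exists>i. \<omega> ` {0<..1} \<subseteq> stratum F i - Y)}"

definition holink_s_at ::
  "'a topology \<Rightarrow> (int \<Rightarrow> 'a set) \<Rightarrow> int \<Rightarrow> 'a \<Rightarrow> (real \<Rightarrow> 'a) set" where
  "holink_s_at X F i x = {\<omega> \<in> holink_s X F (stratum F i). \<omega> 0 = x}"

abbreviation path_subspace :: "'a topology \<Rightarrow> (real \<Rightarrow> 'a) set \<Rightarrow> (real \<Rightarrow> 'a) topology" where
  "path_subspace X H \<equiv> subtopology (compact_open unit_interval X) H"

definition endpoint_filtration :: "(int \<Rightarrow> 'a set) \<Rightarrow> (real \<Rightarrow> 'a) set \<Rightarrow> int \<Rightarrow> (real \<Rightarrow> 'a) set" where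
  "endpoint_filtration F H i = {\<omega> \<in> H. \<omega> 1 \<in> F i}"

lemma stratum_endpoint_filtration:
  "stratum (endpoint_filtration F H) i = {\<omega> \<in> H. \<omega> 1 \<in> stratum F i}"
  by (auto simp: stratum_def endpoint_filtration_def)

section \<open>Fibrations\<close>

text \<open>
  The homotopy lifting property refers to all spaces \<open>Z\<close>, but a definition in HOL cannot
  quantify over the type of points of \<open>Z\<close>. Here \<open>Z\<close> ranges over all topologies on the fixed type
  \<^typ>\<open>'e \<times> (real \<Rightarrow> 'b)\<close>, which contains every pair of a point of the total space and a path in
  the base. This is no restriction: by \<open>fibration_lifting\<close> below, the property
  follows for spaces \<open>Z\<close> with points in an arbitrary type.
\<close>

definition fibration :: "'e topology \<Rightarrow> 'b topology \<Rightarrow> ('e \<Rightarrow> 'b) \<Rightarrow> bool" where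
  "fibration E B p \<longleftrightarrow>
     continuous_map E B p \<and>
     (\<forall>(Z :: ('e \<times> (real \<Rightarrow> 'b)) topology) f H.
        continuous_map Z E f \<and>
        continuous_map (prod_topology Z unit_interval) B H \<and>
        (\<forall>z\<in>topspace Z. H (z, 0) = p (f z)) \<longrightarrow>
        (\<exists>G. continuous_map (prod_topology Z unit_interval) E G \<and>
             (\<forall>z\<in>topspace Z. G (z, 0) = f z) \<and>
             (\<forall>z\<in>topspace Z. \<forall>t\<in>{0..1}. p (G (z, t)) = H (z, t))))"

lemma quotient_map_exists:
  fixes Z :: "'z topology" and \<phi> :: "'z \<Rightarrow> 'w"
  obtains W where "quotient_map Z W \<phi>" 
proof -
  define P where "P U \<longleftrightarrow> U \<subseteq> \<phi> ` topspace Z \<and> openin Z {z \<in> topspace Z. \<phi> z \<in> U}" for U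
  have "istopology P"
    unfolding istopology_def
  proof (intro conjI allI impI)
    fix S T assume "P S" "P T"
    moreover have "{z \<in> topspace Z. \<phi> z \<in> S \<inter> T} =
      {z \<in> topspace Z. \<phi> z \<in> S} \<inter> {z \<in> topspace Z. \<phi> z \<in> T}"
      by auto
    ultimately show "P (S \<inter> T)"
      by (auto simp: P_def)
  next
    fix \<K> assume "\<forall>K\<in>\<K>. P K"
    moreover have "{z \<in> topspace Z. \<phi> z \<in> \<Union>\<K>} = (\<Union>K\<in>\<K>. {z \<in> topspace Z. \<phi> z \<in> K})"
      by auto
    ultimately show "P (\<Union>\<K>)"
      by (auto simp: P_def)
  qed
  then have op: "openin (topology P) U \<longleftrightarrow> P U" for U
    by (simp add: topology_inverse')
  have "{z \<in> topspace Z. \<phi> z \<in> \<phi> ` topspace Z} = topspace Z"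
    by auto
  then have "P (\<phi> ` topspace Z)"
    by (simp add: P_def)
  then have top: "topspace (topology P) = \<phi> ` topspace Z"
    unfolding topspace_def[of "topology P"] op by (auto simp: P_def)
  have "quotient_map Z (topology P) \<phi>"
    unfolding quotient_map_def top op by (auto simp: P_def)
  then show thesis
    by (rule that)
qed

lemma homotopy_lifting_data_factor:
  fixes Z :: "'z topology" and E :: "'e topology" and B :: "'b topology"
  assumes f: "continuous_map Z E f"
    and H: "continuous_map (prod_topology Z unit_interval) B H"
  obtains W :: "('e \<times> (real \<Rightarrow> 'b)) topology" and \<phi> f' H'
  where "quotient_map Z W \<phi>" "continuous_map W E f'"
    "continuous_map (prod_topology W unit_interval) B H'"
    "\<And>z. z \<in> topspace Z \<Longrightarrow> f' (\<phi> z) = f z"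
    "\<And>z t. z \<in> topspace Z \<Longrightarrow> t \<in> {0..1} \<Longrightarrow> H' (\<phi> z, t) = H (z, t)"
proof -
  define \<phi> where "\<phi> z = (f z, \<lambda>t. H (z, t))" for z
  obtain W where W: "quotient_map Z W \<phi>"
    by (rule quotient_map_exists)
  have "locally_compact_space unit_interval"
    by (simp add: compact_imp_locally_compact_space compact_space_subtopology)
  moreover have "Hausdorff_space unit_interval"
    by (simp add: Hausdorff_space_subtopology)
  ultimately have W2: "quotient_map (prod_topology Z unit_interval) (prod_topology W unit_interval)
      (\<lambda>(z, t). (\<phi> z, t))"
    using W by (intro quotient_map_prod_left) auto
  define H' where "H' = (\<lambda>(w :: 'e \<times> (real \<Rightarrow> 'b), t). snd w t)"
  have "continuous_map W E fst"
    using f by (intro continuous_compose_quotient_map[OF W]) (simp add: comp_def \<phi>_def)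
  moreover have "H' \<circ> (\<lambda>(z, t). (\<phi> z, t)) = H"
    by (auto simp: H'_def \<phi>_def)
  then have "continuous_map (prod_topology W unit_interval) B H'"
    using H by (intro continuous_compose_quotient_map[OF W2]) simp
  ultimately show thesis
    using W by (rule_tac that[of W \<phi> fst H']) (auto simp: \<phi>_def H'_def)
qed

lemma fibration_lifting:
  fixes Z :: "'z topology"
  assumes fib: "fibration E B p"
    and f: "continuous_map Z E f"
    and H: "continuous_map (prod_topology Z unit_interval) B H"
    and H0: "\<And>z. z \<in> topspace Z \<Longrightarrow> H (z, 0) = p (f z)"
  obtains G where "continuous_map (prod_topology Z unit_interval) E G"
    "\<And>z. z \<in> topspace Z \<Longrightarrow> G (z, 0) = f z"
    "\<And>z t. z \<in> topspace Z \<Longrightarrow> t \<in> {0..1} \<Longrightarrow> p (G (z, t)) = H (z, t)"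
proof -
  obtain W :: "('a \<times> (real \<Rightarrow> 'b)) topology" and \<phi> f' H'
    where W: "quotient_map Z W \<phi>" "continuous_map W E f'"
      "continuous_map (prod_topology W unit_interval) B H'"
      and f': "\<And>z. z \<in> topspace Z \<Longrightarrow> f' (\<phi> z) = f z"
      and H': "\<And>z t. z \<in> topspace Z \<Longrightarrow> t \<in> {0..1} \<Longrightarrow> H' (\<phi> z, t) = H (z, t)"
    using homotopy_lifting_data_factor[OF f H] by metis
  have im: "topspace W = \<phi> ` topspace Z"
    using W(1) by (simp add: quotient_map_def)
  have "\<forall>w\<in>topspace W. H' (w, 0) = p (f' w)"
    using f' H' H0 by (auto simp: im)
  then obtain G where G: "continuous_map (prod_topology W unit_interval) E G"
      "\<forall>w\<in>topspace W. G (w, 0) = f' w"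
      "\<forall>w\<in>topspace W. \<forall>t\<in>{0..1}. p (G (w, t)) = H' (w, t)"
    using fib[unfolded fibration_def, THEN conjunct2, rule_format, of W f' H'] W by blast
  have "continuous_map (prod_topology Z unit_interval) (prod_topology W unit_interval)
      (\<lambda>(z, t). (\<phi> z, t))"
    using quotient_imp_continuous_map[OF W(1)]
    by (simp add: continuous_map_prod_top)
  from continuous_map_compose[OF this G(1)] show thesis
    by (rule that) (use G f' H' in \<open>auto simp: im\<close>)
qed

section \<open>Manifold homotopically stratified spaces\<close>

definition topological_manifold :: "nat \<Rightarrow> 'a topology \<Rightarrow> bool" where
  "topological_manifold n M \<longleftrightarrow>
     Hausdorff_space M \<and> second_countable M \<and>
     (\<forall>x\<in>topspace M. \<exists>U. openin M U \<and> x \<in> U \<and>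
        subtopology M U homeomorphic_space Euclidean_space n)"

definition locally_closedin :: "'a topology \<Rightarrow> 'a set \<Rightarrow> bool" where
  "locally_closedin X S \<longleftrightarrow> (\<exists>U C. openin X U \<and> closedin X C \<and> S = U \<inter> C)"

definition MHSS :: "'a topology \<Rightarrow> (int \<Rightarrow> 'a set) \<Rightarrow> bool" where
  "MHSS X F \<longleftrightarrow>
     filtered_space X F \<and>
     locally_compact_space X \<and> separable_space X \<and> metrizable_space X \<and>
     (\<forall>i\<ge>0. topological_manifold (nat i) (subtopology X (stratum F i)) \<and>
            locally_closedin X (stratum F i)) \<and>
     (\<forall>i k. i < k \<longrightarrow>
        (let V = stratum F i \<union> stratum F k;
             XV = subtopology X V; FV = restrict_filtration F V
         in forward_tame XV FV (stratum F i) \<and>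
            fibration (path_subspace XV (holink_s XV FV (stratum F i)))
              (subtopology X (stratum F i)) (\<lambda>\<omega>. \<omega> 0))) \<and>
     (\<forall>i. \<forall>x\<in>stratum F i.
        (let H = holink_s_at X F i x; L = path_subspace X H
         in \<exists>h K. continuous_map (prod_topology L unit_interval) L h \<and>
              stratum_preserving_along (endpoint_filtration F H) H {0..1} h \<and>
              (\<forall>\<omega>\<in>H. h (\<omega>, 0) = \<omega>) \<and>
              compactin L K \<and> (\<forall>\<omega>\<in>H. h (\<omega>, 1) \<in> K)))"

definition pure_subset :: "'a topology \<Rightarrow> (int \<Rightarrow> 'a set) \<Rightarrow> 'a set \<Rightarrow> bool" where
  "pure_subset X F Y \<longleftrightarrow>
     closedin X Y \<and>
     (\<exists>\<C> \<subseteq> (\<Union>i. connected_components_of (subtopology X (stratum F i))). Y = \<Union>\<C>)"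

section \<open>Nearly stratum-preserving deformation retract neighborhoods\<close>

definition NSDRN :: "'a topology \<Rightarrow> (int \<Rightarrow> 'a set) \<Rightarrow> 'a set \<Rightarrow> 'a set \<Rightarrow> bool" where
  "NSDRN X F Y N \<longleftrightarrow>
     neighborhood X N Y \<and>
     (\<exists>r. continuous_map (prod_topology (subtopology X N) unit_interval) (subtopology X N) r \<and>
        (\<forall>x\<in>N. r (x, 0) = x) \<and>
        (\<forall>y\<in>Y. \<forall>t\<in>{0..1}. r (y, t) = y) \<and>
        (\<lambda>x. r (x, 1)) ` N = Y \<and>
        stratum_preserving_along (restrict_filtration F N) N {0..<1} r)"

section \<open>Approximate tubular neighborhoods\<close>

text \<open>
  As for \<open>fibration\<close>, the space \<open>Z\<close> ranges over the topologies on a type that is large enough;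
  \<open>MSAF_lifting\<close> gives the property for arbitrary \<open>Z\<close>.
\<close>

definition MSAF ::
  "'a topology \<Rightarrow> (int \<Rightarrow> 'a set) \<Rightarrow> 'b topology \<Rightarrow> (int \<Rightarrow> 'b set) \<Rightarrow> ('a \<Rightarrow> 'b) \<Rightarrow> bool" where
  "MSAF A FA B FB q \<longleftrightarrow>
     MHSS A FA \<and> MHSS B FB \<and> continuous_map A B q \<and> proper_map A B q \<and>
     (\<forall>(Z :: ('a \<times> (real \<Rightarrow> 'b)) topology) f H.
        continuous_map Z A f \<and>
        continuous_map (prod_topology Z unit_interval) B H \<and>
        stratum_preserving_along FB (topspace Z) {0..1} H \<and>
        (\<forall>z\<in>topspace Z. H (z, 0) = q (f z)) \<longrightarrow>
        (\<exists>G. continuous_map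
               (prod_topology Z (prod_topology unit_interval (top_of_set {0..<1}))) A G \<and>
             stratum_preserving_along FA (topspace Z) ({0..1} \<times> {0..<1}) G \<and>
             (\<forall>z\<in>topspace Z. \<forall>s\<in>{0..<1}. G (z, 0, s) = f z) \<and>
             continuous_map
               (prod_topology Z (prod_topology unit_interval unit_interval)) B
               (\<lambda>(z, t, s). if s < 1 then q (G (z, t, s)) else H (z, t))))"

lemma MSAF_lifting:
  fixes Z :: "'z topology"
  assumes msaf: "MSAF A FA B FB q"
    and f: "continuous_map Z A f"
    and H: "continuous_map (prod_topology Z unit_interval) B H"
    and sp: "stratum_preserving_along FB (topspace Z) {0..1} H"
    and H0: "\<And>z. z \<in> topspace Z \<Longrightarrow> H (z, 0) = q (f z)"
  obtains G where
    "continuous_map (prod_topology Z (prod_topology unit_interval (top_of_set {0..<1}))) A G"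
    "stratum_preserving_along FA (topspace Z) ({0..1} \<times> {0..<1}) G"
    "\<And>z s. z \<in> topspace Z \<Longrightarrow> s \<in> {0..<1} \<Longrightarrow> G (z, 0, s) = f z"
    "continuous_map (prod_topology Z (prod_topology unit_interval unit_interval)) B
       (\<lambda>(z, t, s). if s < 1 then q (G (z, t, s)) else H (z, t))"
proof -
  obtain W :: "('a \<times> (real \<Rightarrow> 'b)) topology" and \<phi> f' H'
    where W: "quotient_map Z W \<phi>" "continuous_map W A f'"
      "continuous_map (prod_topology W unit_interval) B H'"
      and f': "\<And>z. z \<in> topspace Z \<Longrightarrow> f' (\<phi> z) = f z"
      and H': "\<And>z t. z \<in> topspace Z \<Longrightarrow> t \<in> {0..1} \<Longrightarrow> H' (\<phi> z, t) = H (z, t)"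
    using homotopy_lifting_data_factor[OF f H] by metis
  have im: "topspace W = \<phi> ` topspace Z"
    using W(1) by (simp add: quotient_map_def)
  have "\<forall>w\<in>topspace W. H' (w, 0) = q (f' w)"
    using f' H' H0 by (auto simp: im)
  moreover have "stratum_preserving_along FB (topspace W) {0..1} H'"
    unfolding stratum_preserving_along_def im
  proof (intro ballI)
    fix w assume "w \<in> \<phi> ` topspace Z"
    then obtain z where w: "w = \<phi> z" and z: "z \<in> topspace Z"
      by blast
    obtain i where "H ` ({z} \<times> {0..1}) \<subseteq> stratum FB i"
      using sp z unfolding stratum_preserving_along_def by blast
    then have "H' ` ({w} \<times> {0..1}) \<subseteq> stratum FB i"
      using H'[OF z] by (auto simp: w image_subset_iff)
    then show "\<exists>i. H' ` ({w} \<times> {0..1}) \<subseteq> stratum FB i" ..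
  qed
  ultimately obtain G where
    G: "continuous_map (prod_topology W (prod_topology unit_interval (top_of_set {0..<1}))) A G"
      "stratum_preserving_along FA (topspace W) ({0..1} \<times> {0..<1}) G"
      "\<forall>w\<in>topspace W. \<forall>s\<in>{0..<1}. G (w, 0, s) = f' w"
      "continuous_map (prod_topology W (prod_topology unit_interval unit_interval)) B
         (\<lambda>(w, t, s). if s < 1 then q (G (w, t, s)) else H' (w, t))"
    using msaf[unfolded MSAF_def, THEN conjunct2, THEN conjunct2, THEN conjunct2, THEN conjunct2,
        rule_format, of W f' H'] W by blast
  have \<phi>: "continuous_map (prod_topology Z T) (prod_topology W T) (\<lambda>(z, t). (\<phi> z, t))"
    for T :: "(real \<times> real) topology"
    using quotient_imp_continuous_map[OF W(1)]
    by (simp add: continuous_map_prod_top)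
  show thesis
  proof (rule that[of "G \<circ> (\<lambda>(z, t). (\<phi> z, t))"])
    show "stratum_preserving_along FA (topspace Z) ({0..1} \<times> {0..<1}) (G \<circ> (\<lambda>(z, t). (\<phi> z, t)))"
      using G(2) by (simp add: stratum_preserving_along_def im image_subset_iff)
    show "continuous_map (prod_topology Z (prod_topology unit_interval unit_interval)) B
       (\<lambda>(z, t, s). if s < 1 then q ((G \<circ> (\<lambda>(z, t). (\<phi> z, t))) (z, t, s)) else H (z, t))"
      by (rule continuous_map_eq[OF continuous_map_compose[OF \<phi> G(4)]]) (auto simp: H')
  qed (use G f' continuous_map_compose[OF \<phi> G(1)] in \<open>auto simp: im\<close>)
qed

definition teardrop_points :: "'a topology \<Rightarrow> 'b topology \<Rightarrow> ('a + 'b) set" where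
  "teardrop_points W Y = Inl ` topspace W \<union> Inr ` topspace Y"

definition teardrop_collapse :: "('a \<Rightarrow> 'b \<times> real) \<Rightarrow> 'a + 'b \<Rightarrow> 'b \<times> ereal" where
  "teardrop_collapse p =
     case_sum (\<lambda>x. (fst (p x), ereal (snd (p x)))) (\<lambda>y. (y, \<infinity>))"

definition teardrop :: "'a topology \<Rightarrow> 'b topology \<Rightarrow> ('a \<Rightarrow> 'b \<times> real) \<Rightarrow> ('a + 'b) topology" where
  "teardrop W Y p =
     topology_generated_by
       ({Inl ` U | U. openin W U} \<union>
        {{z \<in> teardrop_points W Y. teardrop_collapse p z \<in> V} | V.
           openin (prod_topology Y (top_of_set {-\<infinity><..})) V})"

text \<open>
  For continuous \<open>p\<close>, this is the minimal topology on \<open>W \<squnion> Y\<close> for which \<open>W\<close> is openly embedded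
  and the collapse \<open>c\<close> is continuous.
\<close>

definition teardrop_admissible ::
  "'a topology \<Rightarrow> 'b topology \<Rightarrow> ('a \<Rightarrow> 'b \<times> real) \<Rightarrow> ('a + 'b) topology \<Rightarrow> bool" where
  "teardrop_admissible W Y p T \<longleftrightarrow>
     topspace T = teardrop_points W Y \<and>
     embedding_map W T Inl \<and> open_map W T Inl \<and>
     continuous_map T (prod_topology Y (top_of_set {-\<infinity><..})) (teardrop_collapse p)"

lemma teardrop_minimal:
  assumes "teardrop_admissible W Y p T" "openin (teardrop W Y p) U"
  shows "openin T U"
proof -
  have "generate_topology_on
       ({Inl ` U | U. openin W U} \<union>
        {{z \<in> teardrop_points W Y. teardrop_collapse p z \<in> V} | V.
           openin (prod_topology Y (top_of_set {-\<infinity><..})) V}) U"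
    using assms(2) by (simp add: teardrop_def openin_topology_generated_by)
  then show ?thesis
    by (rule generate_topology_on_coarsest[rotated 2])
      (use assms(1) in \<open>auto simp: teardrop_admissible_def open_map_def continuous_map_def\<close>)
qed

lemma teardrop_admissible_teardrop:
  assumes p: "continuous_map W (prod_topology Y euclideanreal) p"
  shows "teardrop_admissible W Y p (teardrop W Y p)"
proof -
  let ?C = "prod_topology Y (top_of_set {-\<infinity>::ereal<..})"
  have pY: "fst (p x) \<in> topspace Y" if "x \<in> topspace W" for x
    using continuous_map_image_subset_topspace[OF p] that by fastforce
  have c: "teardrop_collapse p z \<in> topspace ?C" if "z \<in> teardrop_points W Y" for z
    using that by (auto simp: teardrop_points_def teardrop_collapse_def pY)
  have top: "topspace (teardrop W Y p) = teardrop_points W Y"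
  proof
    show "topspace (teardrop W Y p) \<subseteq> teardrop_points W Y"
      unfolding teardrop_def topology_generated_by_topspace
      by (auto simp: teardrop_points_def dest: openin_subset)
    have "{z \<in> teardrop_points W Y. teardrop_collapse p z \<in> topspace ?C} = teardrop_points W Y"
      using c by auto
    then show "teardrop_points W Y \<subseteq> topspace (teardrop W Y p)"
      unfolding teardrop_def topology_generated_by_topspace by blast
  qed
  have open_c: "openin (teardrop W Y p) {z \<in> teardrop_points W Y. teardrop_collapse p z \<in> V}"
    if "openin ?C V" for V
    unfolding teardrop_def by (rule topology_generated_by_Basis) (use that in blast)
  have open_Inl: "openin (teardrop W Y p) (Inl ` U)" if "openin W U" for U
    unfolding teardrop_def by (rule topology_generated_by_Basis) (use that in blast)
  have "continuous_map euclideanreal (top_of_set {-\<infinity><..}) ereal"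
    by (simp add: continuous_map_in_subtopology continuous_on_ereal)
  then have "continuous_map (prod_topology Y euclideanreal) ?C (\<lambda>(y, t). (y, ereal t))"
    by (simp add: continuous_map_prod_top)
  from continuous_map_compose[OF p this]
  have cp: "continuous_map W ?C (\<lambda>x. teardrop_collapse p (Inl x))"
    by (simp add: comp_def case_prod_unfold teardrop_collapse_def)
  have "continuous_map W (teardrop W Y p) Inl"
    unfolding teardrop_def
  proof (rule continuous_on_generated_topo)
    fix U assume "U \<in> {Inl ` U | U. openin W U} \<union>
        {{z \<in> teardrop_points W Y. teardrop_collapse p z \<in> V} | V. openin ?C V}"
    then consider U' where "openin W U'" "U = Inl ` U'"
      | V where "openin ?C V" "U = {z \<in> teardrop_points W Y. teardrop_collapse p z \<in> V}"
      by blast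
    then show "openin W (Inl -` U \<inter> topspace W)"
    proof cases
      case 1
      then have "Inl -` U \<inter> topspace W = U'"
        using openin_subset by auto
      with 1 show ?thesis by simp
    next
      case 2
      then have "Inl -` U \<inter> topspace W = {x \<in> topspace W. teardrop_collapse p (Inl x) \<in> V}"
        by (auto simp: teardrop_points_def)
      with cp 2 show ?thesis by (simp add: continuous_map_def)
    qed
  next
    show "Inl ` topspace W \<subseteq> \<Union> ({Inl ` U | U. openin W U} \<union>
        {{z \<in> teardrop_points W Y. teardrop_collapse p z \<in> V} | V. openin ?C V})"
      by blast
  qed
  moreover have "open_map W (teardrop W Y p) Inl"
    by (simp add: open_map_def open_Inl)
  ultimately have "embedding_map W (teardrop W Y p) Inl"
    by (intro injective_open_imp_embedding_map) auto
  moreover have "continuous_map (teardrop W Y p) ?C (teardrop_collapse p)"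
    using c open_c by (auto simp: continuous_map_def top)
  ultimately show ?thesis
    using \<open>open_map W (teardrop W Y p) Inl\<close> top by (simp add: teardrop_admissible_def)
qed

definition approximate_tubular_neighborhood ::
  "'a topology \<Rightarrow> (int \<Rightarrow> 'a set) \<Rightarrow> 'a set \<Rightarrow> 'a set \<Rightarrow> bool" where
  "approximate_tubular_neighborhood X F Y N \<longleftrightarrow>
     neighborhood X N Y \<and>
     (\<exists>p. MSAF (subtopology X (N - Y)) (restrict_filtration F (N - Y))
            (prod_topology (subtopology X Y) euclideanreal)
            (times_real_filtration (restrict_filtration F Y)) p \<and>
          homeomorphic_map (teardrop (subtopology X (N - Y)) (subtopology X Y) p)
            (subtopology X N) (case_sum (\<lambda>x. x) (\<lambda>y. y)))"

end

theory Submission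
  imports Defs
begin

text \<open>
  Let \<open>W = N - Y\<close> and let \<open>p = (p\<^sub>1, p\<^sub>2) : W \<rightarrow> Y \<times> \<real>\<close> be the approximate fibration whose teardrop
  is \<open>N\<close>. A point of \<open>W\<close> is close to \<open>y \<in> Y\<close> exactly when \<open>p\<^sub>1\<close> is close to \<open>y\<close> and \<open>p\<^sub>2\<close> is large.
  So \<open>N\<close> retracts to \<open>Y\<close> if every point of \<open>W\<close> can be moved, inside its stratum, so that the image
  under \<open>p\<close> follows approximately the path from \<open>(p\<^sub>1 x, p\<^sub>2 x)\<close> up to \<open>(p\<^sub>1 x, \<infinity>)\<close>: the limit at
  time \<open>1\<close> is then \<open>p\<^sub>1 x \<in> Y\<close>.

  The lifting property concerns compact homotopies, whereas the upward push needs infinite length.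
  The time of the push is therefore made a coordinate of the parameter space: over
  \<open>Z = W \<times> [0,1)\<close> the homotopy \<open>H ((x, t), \<tau>) = (p\<^sub>1 x, p\<^sub>2 x + \<tau> t / (1 - t))\<close> is lifted, and the lift
  is evaluated on the diagonal \<open>\<tau> = t\<close>. There it starts at \<open>x\<close> for \<open>t = 0\<close>, and its height
  \<open>p\<^sub>2 x + t\<^sup>2 / (1 - t)\<close> tends to infinity for \<open>t \<rightarrow> 1\<close>.

  The lift is only approximate: it has a further parameter \<open>u \<in> [0,1)\<close>, and lies over \<open>H\<close> in the limit
  \<open>u \<rightarrow> 1\<close>. As \<open>Z\<close> is metrizable, \<open>u\<close> can be chosen as a continuous function of \<open>(x, t)\<close> for which the
  error is as small as desired (\<open>continuous_map_below_top\<close>). An error less than \<open>1\<close> in the height, and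
  less than the reciprocal of the height in \<open>Y\<close> (\<open>MSAF_controlled_push\<close>), vanishes fast enough near
  \<open>Y\<close> and near time \<open>1\<close> for the extended deformation to be continuous in the teardrop topology
  (\<open>continuous_map_push_teardrop\<close>).
\<close>

section \<open>Topological preliminaries\<close>

lemma metrizable_space_as_metric:
  assumes "metrizable_space X"
  obtains m where "X = mtopology_of m"
  using assms unfolding metrizable_space_def by (metis Metric_space.mtopology_of)

text \<open>
  This turns a limit \<open>u \<rightarrow> 1\<close> into a continuous choice of \<open>u < 1\<close>. If \<open>a z\<close> is the distance from
  \<open>(z, 1)\<close> to the complement of \<open>Q\<close>, then \<open>a\<close> is Lipschitz and positive, and \<open>(z, 1 - a z / 2)\<close> is too
  close to \<open>(z, 1)\<close> to lie outside \<open>Q\<close>.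
\<close>

lemma continuous_map_below_top:
  assumes Z: "metrizable_space Z"
    and Q: "openin (prod_topology Z unit_interval) Q"
    and top: "\<And>z. z \<in> topspace Z \<Longrightarrow> (z, 1) \<in> Q"
  obtains \<phi> where "continuous_map Z (top_of_set {0..<1}) \<phi>"
    "\<And>z. z \<in> topspace Z \<Longrightarrow> (z, \<phi> z) \<in> Q"
proof -
  obtain M d where M: "Metric_space M d" and Zd: "Z = Metric_space.mtopology M d"
    using Z by (auto simp: metrizable_space_def)
  interpret Metric_space M d by (rule M)
  \<comment> \<open>The element \<open>1\<close> keeps the infimum meaningful when the complement of \<open>Q\<close> is empty, and
    ensures \<open>a z \<le> 1\<close>.\<close>
  define D where "D z = insert 1 {d z z' + (1 - u) | z' u. z' \<in> M \<and> u \<in> {0..1} \<and> (z', u) \<notin> Q}" for z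
  define a where "a z = Inf (D z)" for z
  have D0: "x \<ge> 0" if "x \<in> D z" for x z
    using that by (auto simp: D_def)
  then have bdd: "bdd_below (D z)" for z
    by (meson bdd_belowI)
  have ne: "D z \<noteq> {}" for z
    by (simp add: D_def)
  have a_le1: "a z \<le> 1" for z
    unfolding a_def by (rule cInf_lower[OF _ bdd]) (simp add: D_def)
  have a_le: "a z \<le> d z z' + (1 - u)" if "z' \<in> M" "u \<in> {0..1}" "(z', u) \<notin> Q" for z z' u
    unfolding a_def by (rule cInf_lower[OF _ bdd]) (use that in \<open>auto simp: D_def\<close>)
  have a_pos: "a z > 0" if z: "z \<in> M" for z
  proof -
    have "(z, 1) \<in> Q" using top z by (simp add: Zd)
    then obtain U V where UV: "openin Z U" "openin unit_interval V" "z \<in> U" "1 \<in> V" "U \<times> V \<subseteq> Q"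
      using Q unfolding openin_prod_topology_alt by meson
    obtain e where e: "e > 0" "mball z e \<subseteq> U"
      using UV unfolding Zd openin_mtopology by blast
    obtain e' where e': "e' > 0" "\<And>u. u \<in> {0..1} \<Longrightarrow> dist u 1 < e' \<Longrightarrow> u \<in> V"
      using UV(2,4) unfolding openin_euclidean_subtopology_iff by blast
    define b where "b = Min {1, e, e'}"
    have b: "b > 0" "b \<le> 1" "b \<le> e" "b \<le> e'"
      using e e' by (auto simp: b_def)
    have "b \<le> x" if xD: "x \<in> D z" for x
    proof (rule ccontr)
      assume "\<not> b \<le> x"
      then obtain z' u where x: "x = d z z' + (1 - u)" and zu: "z' \<in> M" "u \<in> {0..1}" "(z', u) \<notin> Q"
        using xD b by (auto simp: D_def)
      have "d z z' < e" and "1 - u < e'"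
        using \<open>\<not> b \<le> x\<close> x b zu(2) nonneg[of z z'] unfolding atLeastAtMost_iff by linarith+
      then have "d z z' < e" "dist u 1 < e'"
        using zu(2) by (auto simp: dist_real_def)
      then have "(z', u) \<in> Q"
        using e e' UV zu z by (auto simp: subset_iff)
      with zu show False by simp
    qed
    then have "b \<le> a z"
      unfolding a_def by (intro cInf_greatest ne)
    with b show ?thesis by simp
  qed
  have lip: "a z \<le> a w + d z w" if "z \<in> M" "w \<in> M" for z w
  proof -
    have "a z - d z w \<le> 1"
      using a_le1[of z] nonneg[of z w] by linarith
    moreover have "a z - d z w \<le> d w z' + (1 - u)"
      if "z' \<in> M" "u \<in> {0..1}" "(z', u) \<notin> Q" for z' u
      using a_le[OF that, of z] triangle[of z w z'] \<open>z \<in> M\<close> \<open>w \<in> M\<close> that(1) by simp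
    ultimately have "a z - d z w \<le> x" if "x \<in> D w" for x
      using that unfolding D_def by blast
    then have "a z - d z w \<le> a w"
      unfolding a_def[of w] by (intro cInf_greatest ne)
    then show ?thesis by simp
  qed
  have "\<exists>U. openin Z U \<and> z \<in> U \<and> (\<forall>w\<in>U. dist (a z) (a w) < e)"
    if z: "z \<in> topspace Z" and e: "e > 0" for z e
  proof (intro exI conjI ballI)
    show "openin Z (mball z e)" "z \<in> mball z e"
      using z e by (auto simp: Zd)
    show "dist (a z) (a w) < e" if "w \<in> mball z e" for w
      using lip[of z w] lip[of w z] that by (auto simp: dist_real_def commute)
  qed
  then have "continuous_map Z euclideanreal a"
    using Met_TC.continuous_map_to_metric[of Z a] by simp
  then have "continuous_map Z euclideanreal (\<lambda>z. 1 - a z / 2)"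
    by (intro continuous_intros) auto
  moreover have "1 - a z / 2 \<in> {0..<1}" if "z \<in> topspace Z" for z
    using a_pos[of z] a_le1[of z] that by (simp add: Zd)
  ultimately have "continuous_map Z (top_of_set {0..<1}) (\<lambda>z. 1 - a z / 2)"
    by (simp add: continuous_map_in_subtopology Pi_iff)
  moreover have "(z, 1 - a z / 2) \<in> Q" if z: "z \<in> topspace Z" for z
  proof (rule ccontr)
    assume "(z, 1 - a z / 2) \<notin> Q"
    moreover have zM: "z \<in> M" using z Zd by simp
    ultimately show False
      using a_le[of z "1 - a z / 2" z] a_pos[OF zM] a_le1[of z] by simp
  qed
  ultimately show thesis
    by (rule that)
qed

lemma open_map_prod_inclusion:
  assumes i: "open_map W T i"
  shows "open_map (prod_topology W (top_of_set {0..<1::real})) (prod_topology T unit_interval)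
           (\<lambda>(x, t). (i x, t))"
  unfolding open_map_def
proof (intro allI impI)
  fix S assume S: "openin (prod_topology W (top_of_set {0..<1::real})) S"
  show "openin (prod_topology T unit_interval) ((\<lambda>(x, t). (i x, t)) ` S)"
    unfolding openin_prod_topology_alt
  proof (intro allI impI)
    fix y t assume "(y, t) \<in> (\<lambda>(x, t). (i x, t)) ` S"
    then obtain x where x: "y = i x" "(x, t) \<in> S" by auto
    then obtain U V where UV: "openin W U" "openin (top_of_set {0..<1}) V" "x \<in> U" "t \<in> V"
        "U \<times> V \<subseteq> S"
      using S unfolding openin_prod_topology_alt by meson
    have "openin unit_interval {0..<1::real}"
      by (auto simp: openin_open intro!: exI[of _ "{..<1}"])
    then have "openin unit_interval V"
      using UV(2) openin_trans by blast
    then show "\<exists>U V. openin T U \<and> openin unit_interval V \<and> y \<in> U \<and> t \<in> V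
        \<and> U \<times> V \<subseteq> (\<lambda>(x, t). (i x, t)) ` S"
      using UV i x unfolding open_map_def by (intro exI[of _ "i ` U"] exI[of _ V]) force
  qed
qed

lemma stratum_unique:
  assumes "mono F" "x \<in> stratum F i" "x \<in> stratum F j"
  shows "i = j"
proof -
  have "\<not> i < j" if "x \<in> stratum F i" "x \<in> stratum F j" for i j
    using that monoD[OF assms(1), of i "j - 1"] by (auto simp: stratum_def)
  with assms show ?thesis by (meson linorder_cases)
qed

lemma filtered_space_stratum_exists:
  assumes F: "filtered_space X F" and x: "x \<in> topspace X"
  obtains i where "x \<in> stratum F i"
proof -
  obtain n where n: "\<And>i. i \<ge> n \<Longrightarrow> F i = topspace X"
    using F by (auto simp: filtered_space_def)
  define k where "k = (LEAST k::nat. x \<in> F (int k))"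
  have "x \<in> F (int (nat n))" using n x by simp
  then have k: "x \<in> F (int k)"
    unfolding k_def by (rule LeastI)
  have "x \<notin> F (int k - 1)"
  proof (cases "k = 0")
    case True
    then show ?thesis using F by (simp add: filtered_space_def)
  next
    case False
    then show ?thesis
      using not_less_Least[of "k - 1" "\<lambda>k. x \<in> F (int k)"] by (simp add: k_def[symmetric] of_nat_diff)
  qed
  with k show thesis by (intro that[of "int k"]) (simp add: stratum_def)
qed

section \<open>Pushing towards infinity\<close>

text \<open>
  The height over \<open>x\<close> that the push aims at by time \<open>t\<close>. One factor \<open>t\<close> is the time of the lifted
  homotopy, while \<open>t / (1 - t)\<close> is the total length of the homotopy at the parameter \<open>(x, t)\<close>.
\<close>

definition pushed_height :: "('a \<Rightarrow> 'b \<times> real) \<Rightarrow> 'a \<times> real \<Rightarrow> real" where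
  "pushed_height p = (\<lambda>(x, t). snd (p x) + t * (t / (1 - t)))"

text \<open>
  The approximate lift of the upward push, on the diagonal. The starting point is exactly \<open>x\<close>
  because the lift at homotopy time \<open>0\<close> is \<open>x\<close> for every value of the control parameter. The strata
  visited at different \<open>t\<close> agree, although \<open>t\<close> belongs to the parameter space, because each
  lift starts in the stratum of \<open>x\<close>. The last bound is a product, so that it needs no case
  distinction on the sign of the height; it bounds the error only where the height is positive.
\<close>

lemma MSAF_controlled_push:
  fixes W :: "'a topology" and m :: "'b metric"
  assumes msaf: "MSAF W FW (prod_topology (mtopology_of m) euclideanreal)
      (times_real_filtration FY) p"
  obtains g where
    "continuous_map (prod_topology W (top_of_set {0..<1})) W g"
    "\<And>x. x \<in> topspace W \<Longrightarrow> g (x, 0) = x"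
    "\<And>x. x \<in> topspace W \<Longrightarrow> \<exists>i. \<forall>t\<in>{0..<1}. g (x, t) \<in> stratum FW i"
    "\<And>x t. x \<in> topspace W \<Longrightarrow> t \<in> {0..<1} \<Longrightarrow>
       \<bar>snd (p (g (x, t))) - pushed_height p (x, t)\<bar> < 1"
    "\<And>x t. x \<in> topspace W \<Longrightarrow> t \<in> {0..<1} \<Longrightarrow>
       mdist m (fst (p (g (x, t)))) (fst (p x)) * pushed_height p (x, t) < 1"
proof -
  let ?Y = "mtopology_of m"
  let ?B = "prod_topology ?Y euclideanreal"
  define Z where "Z = prod_topology W (top_of_set {0..<1::real})"
  have topZ: "topspace Z = topspace W \<times> {0..<1}"
    by (simp add: Z_def)
  have p: "continuous_map W ?B p"
    using msaf by (simp add: MSAF_def)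
  have fstZ: "continuous_map Z W fst"
    unfolding Z_def by (intro continuous_intros)
  have pZ: "continuous_map Z ?B (\<lambda>z. p (fst z))"
    using continuous_map_compose[OF fstZ p] by (simp add: comp_def)
  have p1: "continuous_map Z ?Y (\<lambda>z. fst (p (fst z)))"
    using continuous_map_compose[OF pZ continuous_map_fst] by (simp add: comp_def)
  have p2: "continuous_map Z euclideanreal (\<lambda>z. snd (p (fst z)))"
    using continuous_map_compose[OF pZ continuous_map_snd] by (simp add: comp_def)
  have sndZ: "continuous_map Z (top_of_set {0..<1}) snd"
    unfolding Z_def by (intro continuous_intros)
  have "continuous_map (top_of_set {0..<1}) euclideanreal (\<lambda>t::real. t / (1 - t))"
    by (auto intro!: continuous_intros)
  from continuous_map_compose[OF sndZ this]
  have s: "continuous_map Z euclideanreal (\<lambda>z. snd z / (1 - snd z))"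
    by (simp add: comp_def)
  have sndZr: "continuous_map Z euclideanreal snd"
    using sndZ by (simp add: continuous_map_in_subtopology)
  have h: "continuous_map Z euclideanreal (pushed_height p)"
    unfolding pushed_height_def case_prod_unfold by (intro continuous_intros p2 s sndZr)
  define H where "H = (\<lambda>(z, \<tau>). (fst (p (fst z)), snd (p (fst z)) + \<tau> * (snd z / (1 - snd z))))"
  have fst': "continuous_map (prod_topology Z unit_interval) Z fst"
    by (intro continuous_intros)
  have snd': "continuous_map (prod_topology Z unit_interval) euclideanreal snd"
    using continuous_map_snd[of Z unit_interval] by (simp add: continuous_map_in_subtopology)
  note lift = continuous_map_compose[OF fst', unfolded comp_def]
  have H: "continuous_map (prod_topology Z unit_interval) ?B H"
    unfolding H_def case_prod_unfold
    by (intro continuous_intros lift[OF p1] lift[OF p2] lift[OF s] snd')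
  have spH: "stratum_preserving_along (times_real_filtration FY) (topspace Z) {0..1} H"
    unfolding stratum_preserving_along_def
  proof
    fix z assume z: "z \<in> topspace Z"
    have "p (fst z) \<in> topspace ?B"
      using continuous_map_image_subset_topspace[OF pZ] z by blast
    moreover have "filtered_space ?B (times_real_filtration FY)"
      using msaf by (simp add: MSAF_def MHSS_def)
    ultimately obtain i where "p (fst z) \<in> stratum (times_real_filtration FY) i"
      using filtered_space_stratum_exists by metis
    \<comment> \<open>\<open>H\<close> changes only the real coordinate, on which the strata do not depend.\<close>
    then have "H ` ({z} \<times> {0..1}) \<subseteq> stratum (times_real_filtration FY) i"
      by (auto simp: H_def stratum_def times_real_filtration_def mem_Times_iff)
    then show "\<exists>i. H ` ({z} \<times> {0..1}) \<subseteq> stratum (times_real_filtration FY) i" ..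
  qed
  have H0: "H (z, 0) = p (fst z)" for z
    by (simp add: H_def)
  obtain G where
    G: "continuous_map (prod_topology Z (prod_topology unit_interval (top_of_set {0..<1}))) W G"
    and spG: "stratum_preserving_along FW (topspace Z) ({0..1} \<times> {0..<1}) G"
    and G0: "\<And>z s. z \<in> topspace Z \<Longrightarrow> s \<in> {0..<1} \<Longrightarrow> G (z, 0, s) = fst z"
    and K: "continuous_map (prod_topology Z (prod_topology unit_interval unit_interval)) ?B
       (\<lambda>(z, t, s). if s < 1 then p (G (z, t, s)) else H (z, t))"
    by (rule MSAF_lifting[OF msaf fstZ H spH H0]) (erule that; blast)
  \<comment> \<open>The image of the lift on the diagonal, extended by the homotopy itself at control
    parameter \<open>u = 1\<close>, where the error is zero.\<close>
  define K' where "K' = (\<lambda>(z, u). if u < 1 then p (G (z, snd z, u)) else H (z, snd z))"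
  have sndI: "continuous_map Z unit_interval snd"
    using sndZr by (auto simp: continuous_map_in_subtopology topZ)
  have diag: "continuous_map (prod_topology Z unit_interval)
      (prod_topology Z (prod_topology unit_interval unit_interval)) (\<lambda>(z, u). (z, snd z, u))"
    unfolding case_prod_unfold by (intro continuous_intros lift[OF sndI])
  from continuous_map_compose[OF this K] have K': "continuous_map (prod_topology Z unit_interval) ?B K'"
    by (simp add: comp_def K'_def case_prod_unfold cong: if_cong)
  define Q where "Q = {w \<in> topspace (prod_topology Z unit_interval).
      \<bar>snd (K' w) - pushed_height p (fst w)\<bar> < 1 \<and>
      mdist m (fst (K' w)) (fst (p (fst (fst w)))) * pushed_height p (fst w) < 1}"
  have "continuous_map (prod_topology Z unit_interval) euclideanreal
      (\<lambda>w. \<bar>snd (K' w) - pushed_height p (fst w)\<bar>)"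
    using continuous_map_compose[OF K' continuous_map_snd]
    by (intro continuous_intros lift[OF h]) (simp add: comp_def)
  from openin_continuous_map_preimage[OF this, of "{..<1}"]
  have Q1: "openin (prod_topology Z unit_interval) {w \<in> topspace (prod_topology Z unit_interval).
      \<bar>snd (K' w) - pushed_height p (fst w)\<bar> < 1}"
    by simp
  have "continuous_map (prod_topology Z unit_interval) euclideanreal
      (\<lambda>w. mdist m (fst (K' w)) (fst (p (fst (fst w)))) * pushed_height p (fst w))"
    using continuous_map_compose[OF K' continuous_map_fst]
    by (intro continuous_intros lift[OF h] lift[OF p1]) (simp add: comp_def)
  from openin_continuous_map_preimage[OF this, of "{..<1}"]
  have "openin (prod_topology Z unit_interval) {w \<in> topspace (prod_topology Z unit_interval).
      mdist m (fst (K' w)) (fst (p (fst (fst w)))) * pushed_height p (fst w) < 1}"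
    by simp
  from openin_Int[OF Q1 this] have Q: "openin (prod_topology Z unit_interval) Q"
    by (rule back_subst) (auto simp: Q_def)
  have "metrizable_space Z"
    using msaf unfolding Z_def metrizable_space_prod_topology
    by (auto simp: MSAF_def MHSS_def metrizable_space_subtopology metrizable_space_euclidean)
  moreover have "(z, 1) \<in> Q" if z: "z \<in> topspace Z" for z
  proof -
    have "fst (p (fst z)) \<in> topspace ?Y"
      using continuous_map_image_subset_topspace[OF p1] z by blast
    then have d0: "mdist m (fst (p (fst z))) (fst (p (fst z))) = 0"
      by simp
    show ?thesis
      using z by (simp add: d0 Q_def K'_def H_def pushed_height_def case_prod_unfold)
  qed
  ultimately obtain \<phi> where \<phi>: "continuous_map Z (top_of_set {0..<1}) \<phi>"
      and \<phi>Q: "\<And>z. z \<in> topspace Z \<Longrightarrow> (z, \<phi> z) \<in> Q"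
    using continuous_map_below_top[OF _ Q] by metis
  have \<phi>1: "\<phi> z \<in> {0..<1}" if "z \<in> topspace Z" for z
    using continuous_map_image_subset_topspace[OF \<phi>] that by force
  define g where "g = (\<lambda>z. G (z, snd z, \<phi> z))"
  have pg: "K' (z, \<phi> z) = p (g z)" if "z \<in> topspace Z" for z
    using \<phi>1[OF that] by (simp add: K'_def g_def)
  show thesis
  proof (rule that[of g])
    have "continuous_map Z (prod_topology Z (prod_topology unit_interval (top_of_set {0..<1})))
        (\<lambda>z. (z, snd z, \<phi> z))"
      by (intro continuous_intros sndI \<phi>)
    from continuous_map_compose[OF this G]
    show "continuous_map (prod_topology W (top_of_set {0..<1})) W g"
      by (simp add: comp_def g_def Z_def)
  next
    fix x assume x: "x \<in> topspace W"
    then show "g (x, 0) = x"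
      using G0[of "(x, 0)" "\<phi> (x, 0)"] \<phi>1[of "(x, 0)"] by (simp add: g_def topZ)
    have "mono FW"
      using msaf by (simp add: MSAF_def MHSS_def filtered_space_def)
    moreover obtain i where i: "x \<in> stratum FW i"
      using x msaf filtered_space_stratum_exists[of W FW] by (auto simp: MSAF_def MHSS_def)
    moreover have "\<exists>j. x \<in> stratum FW j \<and> g (x, t) \<in> stratum FW j" if t: "t \<in> {0..<1}" for t
    proof -
      have z: "(x, t) \<in> topspace Z" using x t by (simp add: topZ)
      then obtain j where "G ` ({(x, t)} \<times> {0..1} \<times> {0..<1}) \<subseteq> stratum FW j"
        using spG unfolding stratum_preserving_along_def by blast
      then have "G ((x, t), 0, 0) \<in> stratum FW j" "g (x, t) \<in> stratum FW j"
        using t \<phi>1[OF z] by (auto simp: g_def)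
      then show ?thesis
        using G0[OF z, of 0] by auto
    qed
    ultimately show "\<exists>i. \<forall>t\<in>{0..<1}. g (x, t) \<in> stratum FW i"
      using stratum_unique by metis
  next
    fix x t assume "x \<in> topspace W" "t \<in> {0..<1::real}"
    then have z: "(x, t) \<in> topspace Z" by (simp add: topZ)
    show "\<bar>snd (p (g (x, t))) - pushed_height p (x, t)\<bar> < 1"
      and "mdist m (fst (p (g (x, t)))) (fst (p x)) * pushed_height p (x, t) < 1"
      using \<phi>Q[OF z] pg[OF z] by (auto simp: Q_def)
  qed
qed

section \<open>The deformation of the teardrop\<close>

lemma continuous_map_into_teardrop:
  assumes f: "\<And>z. z \<in> topspace Z \<Longrightarrow> f z \<in> teardrop_points W Y"
    and Inl: "\<And>U. openin W U \<Longrightarrow> openin Z {z \<in> topspace Z. f z \<in> Inl ` U}"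
    and c: "\<And>V. openin (prod_topology Y (top_of_set {-\<infinity><..})) V \<Longrightarrow>
      openin Z {z \<in> topspace Z. teardrop_collapse p (f z) \<in> V}"
    and p: "continuous_map W (prod_topology Y euclideanreal) p"
  shows "continuous_map Z (teardrop W Y p) f"
  unfolding teardrop_def
proof (rule continuous_on_generated_topo)
  let ?G = "{Inl ` U | U. openin W U} \<union> {{z \<in> teardrop_points W Y. teardrop_collapse p z \<in> V} | V.
      openin (prod_topology Y (top_of_set {-\<infinity><..})) V}"
  fix U assume "U \<in> ?G"
  then consider U' where "openin W U'" "U = Inl ` U'"
    | V where "openin (prod_topology Y (top_of_set {-\<infinity><..})) V"
      "U = {z \<in> teardrop_points W Y. teardrop_collapse p z \<in> V}"
    by blast
  then show "openin Z (f -` U \<inter> topspace Z)"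
  proof cases
    case 1
    from Inl[OF 1(1)] show ?thesis
      by (rule back_subst) (auto simp: 1)
  next
    case 2
    from c[OF 2(1)] show ?thesis
      by (rule back_subst) (auto simp: 2 f)
  qed
next
  have "topspace (teardrop W Y p) = teardrop_points W Y"
    using teardrop_admissible_teardrop[OF p] by (simp add: teardrop_admissible_def)
  then show "f ` topspace Z \<subseteq> \<Union> ({Inl ` U | U. openin W U} \<union>
      {{z \<in> teardrop_points W Y. teardrop_collapse p z \<in> V} | V.
        openin (prod_topology Y (top_of_set {-\<infinity><..})) V})"
    using f unfolding teardrop_def topology_generated_by_topspace by blast
qed

text \<open>
  Away from \<open>Y\<close> and from time \<open>1\<close> the continuity is that of \<open>g\<close>, since \<open>W\<close> is open in the teardrop.
  At the remaining points the collapse of the deformation has height \<open>\<infinity>\<close>. Near such a point the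
  pushed height exceeds any prescribed \<open>K > 0\<close>, so \<open>p \<circ> g\<close> is high and its first coordinate is
  within \<open>1 / K\<close> of \<open>fst \<circ> p\<close>, which extends continuously over the teardrop.
\<close>

lemma continuous_map_push_teardrop:
  fixes W :: "'a topology" and m :: "'b metric"
  defines "Y \<equiv> mtopology_of m"
  assumes p: "continuous_map W (prod_topology Y euclideanreal) p"
    and g: "continuous_map (prod_topology W (top_of_set {0..<1})) W g"
    and g_height: "\<And>x t. x \<in> topspace W \<Longrightarrow> t \<in> {0..<1} \<Longrightarrow>
       \<bar>snd (p (g (x, t))) - pushed_height p (x, t)\<bar> < 1"
    and g_base: "\<And>x t. x \<in> topspace W \<Longrightarrow> t \<in> {0..<1} \<Longrightarrow>
       mdist m (fst (p (g (x, t)))) (fst (p x)) * pushed_height p (x, t) < 1"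
  shows "continuous_map (prod_topology (teardrop W Y p) unit_interval) (teardrop W Y p)
    (\<lambda>(z, t). case z of Inl x \<Rightarrow> if t < 1 then Inl (g (x, t)) else Inr (fst (p x)) | Inr y \<Rightarrow> Inr y)"
    (is "continuous_map ?TI _ ?R")
proof (rule continuous_map_into_teardrop[OF _ _ _ p])
  let ?T = "teardrop W Y p" and ?C = "prod_topology Y (top_of_set {-\<infinity>::ereal<..})"
  let ?WJ = "prod_topology W (top_of_set {0..<1::real})"
  have adm: "teardrop_admissible W Y p ?T"
    by (rule teardrop_admissible_teardrop[OF p])
  then have topT: "topspace ?T = teardrop_points W Y"
    and c: "continuous_map ?T ?C (teardrop_collapse p)"
    and Inl: "open_map W ?T Inl" "continuous_map W ?T Inl"
    by (simp_all add: teardrop_admissible_def continuous_map_in_subtopology embedding_map_def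
        homeomorphic_eq_everything_map)
  have pY: "fst (p x) \<in> topspace Y" if "x \<in> topspace W" for x
    using continuous_map_image_subset_topspace[OF p] that by fastforce
  have gW: "g (x, t) \<in> topspace W" if "x \<in> topspace W" "t \<in> {0..<1}" for x t
    using continuous_map_image_subset_topspace[OF g] that by fastforce
  note push_open = open_map_prod_inclusion[OF Inl(1), unfolded open_map_def, rule_format]
  show "?R w \<in> teardrop_points W Y" if "w \<in> topspace ?TI" for w
    using that pY gW by (auto simp: teardrop_points_def topT)
  show "openin ?TI {w \<in> topspace ?TI. ?R w \<in> Inl ` U}" if U: "openin W U" for U
  proof -
    have "openin ?WJ {w \<in> topspace ?WJ. g w \<in> U}"
      by (rule openin_continuous_map_preimage[OF g U])
    from push_open[OF this] show ?thesis
      by (rule back_subst) (force simp: topT teardrop_points_def split: if_splits)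
  qed
  show "openin ?TI {w \<in> topspace ?TI. teardrop_collapse p (?R w) \<in> V}" (is "openin _ ?P")
    if V: "openin ?C V" for V
  proof (subst openin_subopen, intro ballI)
    fix w assume w: "w \<in> ?P"
    obtain z t where zt: "w = (z, t)" by force
    have z: "z \<in> teardrop_points W Y" and t: "t \<in> {0..1}"
      using w by (auto simp: zt topT)
    define \<rho> where "\<rho> z = fst (teardrop_collapse p z)" for z
    define \<tau> where "\<tau> z = snd (teardrop_collapse p z)" for z
    have \<rho>: "continuous_map ?T Y \<rho>"
      unfolding \<rho>_def using continuous_map_compose[OF c continuous_map_fst] by (simp add: comp_def)
    have "continuous_map ?T (top_of_set {-\<infinity><..}) \<tau>"
      unfolding \<tau>_def using continuous_map_compose[OF c continuous_map_snd] by (simp add: comp_def)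
    then have \<tau>: "continuous_map ?T euclidean \<tau>"
      by (simp add: continuous_map_in_subtopology)
    consider (inside) x where "z = Inl x" "x \<in> topspace W" "t < 1" | (limit) "\<tau> z = \<infinity> \<or> t = 1"
      using z t by (force simp: teardrop_points_def \<tau>_def teardrop_collapse_def)
    then show "\<exists>S. openin ?TI S \<and> w \<in> S \<and> S \<subseteq> ?P"
    proof cases
      case inside
      have "continuous_map ?WJ ?C (\<lambda>w. teardrop_collapse p (Inl (g w)))"
        using continuous_map_compose[OF g continuous_map_compose[OF Inl(2) c]] by (simp add: comp_def)
      from push_open[OF openin_continuous_map_preimage[OF this V]]
      show ?thesis
        using w inside t by (intro exI conjI) (auto simp: zt topT teardrop_points_def)
    next
      case limit
      have "teardrop_collapse p (?R w) = (\<rho> z, \<infinity>)"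
        using limit z by (auto simp: zt \<rho>_def \<tau>_def teardrop_collapse_def teardrop_points_def)
      then have "(\<rho> z, \<infinity>) \<in> V"
        using w by simp
      then obtain V1 V2 where V12: "openin Y V1" "openin (top_of_set {-\<infinity><..}) V2" "\<rho> z \<in> V1"
          "\<infinity> \<in> V2" "V1 \<times> V2 \<subseteq> V"
        using V unfolding openin_prod_topology_alt by meson
      obtain e where e: "e > 0" "mball_of m (\<rho> z) e \<subseteq> V1"
        using V12(1,3) unfolding Y_def mtopology_of_def mball_of_def
        by (meson Metric_space.openin_mtopology Metric_space_mspace_mdist)
      obtain S where S: "open S" "V2 = {-\<infinity><..} \<inter> S"
        using V12(2) by (auto simp: openin_open)
      then obtain b where "{ereal b<..} \<subseteq> S"
        using open_PInfty[of S] V12(4) by auto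
      then have b: "ereal r \<in> V2" if "r > b" for r
        using that by (auto simp: S)
      \<comment> \<open>A pushed height above \<open>b + 1\<close> leaves the actual height above \<open>b\<close>; one above \<open>2 / e\<close> keeps
        the error in \<open>Y\<close> below \<open>e / 2\<close>.\<close>
      define K where "K = max (b + 1) (2 / e)"
      define N1 where "N1 = {z' \<in> topspace ?T. \<rho> z' \<in> mball_of m (\<rho> z) (e / 2)}"
      have "openin Y (mball_of m (\<rho> z) (e / 2))"
        unfolding Y_def mtopology_of_def mball_of_def
        by (rule Metric_space.openin_mball) (rule Metric_space_mspace_mdist)
      then have N1: "openin ?T N1"
        unfolding N1_def by (rule openin_continuous_map_preimage[OF \<rho>])
      have "\<rho> z \<in> mspace m"
        using V12(1,3) openin_subset[of Y V1] by (auto simp: Y_def)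
      moreover from this have \<rho>\<rho>: "mdist m (\<rho> z) (\<rho> z) = 0"
        by simp
      ultimately have zN1: "z \<in> N1"
        using z e by (simp add: N1_def topT \<rho>\<rho>)
      have \<tau>_open: "openin ?T {z' \<in> topspace ?T. \<tau> z' > ereal k}" for k
        using openin_continuous_map_preimage[OF \<tau>, of "{ereal k<..}"] by simp
      obtain N2 J where NJ: "openin ?T N2" "openin unit_interval J" "z \<in> N2" "t \<in> J"
        and high: "\<And>x t'. Inl x \<in> N2 \<Longrightarrow> t' \<in> J \<Longrightarrow> t' < 1 \<Longrightarrow> pushed_height p (x, t') > K"
      proof (cases "\<tau> z = \<infinity>")
        case True
        show thesis
        proof (rule that[OF \<tau>_open[of K], of "{0..1}"])
          fix x t' assume "Inl x \<in> {z' \<in> topspace ?T. \<tau> z' > ereal K}" "t' \<in> {0..1::real}" "t' < 1"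
          then have "snd (p x) > K" "t' * (t' / (1 - t')) \<ge> 0"
            by (simp_all add: \<tau>_def teardrop_collapse_def)
          then show "pushed_height p (x, t') > K"
            unfolding pushed_height_def by (simp del: times_divide_eq_right)
        qed (use True t z in \<open>auto simp: topT\<close>)
      next
        case False
        then have t1: "t = 1" using limit by simp
        have "\<tau> z > -\<infinity>"
          using z by (auto simp: \<tau>_def teardrop_collapse_def teardrop_points_def)
        then obtain k where k: "ereal k < \<tau> z"
          using ereal_dense2 by blast
        \<comment> \<open>The condition \<open>t\<^sup>2 / (1 - t) > K - k\<close>, multiplied out so that it is defined and true at
          \<open>t = 1\<close>.\<close>
        have "openin unit_interval ({0..1} \<inter> {t. (K - k) * (1 - t) < t * t})"
          by (intro openin_open_Int open_Collect_less continuous_intros)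
        then show thesis
        proof (rule that[OF \<tau>_open[of k]])
          fix x t' assume "Inl x \<in> {z' \<in> topspace ?T. \<tau> z' > ereal k}"
            "t' \<in> {0..1} \<inter> {t. (K - k) * (1 - t) < t * t}" "t' < 1"
          then have "snd (p x) > k" "K - k < t' * (t' / (1 - t'))"
            by (simp_all add: \<tau>_def teardrop_collapse_def field_simps)
          then show "pushed_height p (x, t') > K"
            unfolding pushed_height_def by (simp del: times_divide_eq_right)
        qed (use t1 z k in \<open>auto simp: topT\<close>)
      qed
      have "teardrop_collapse p (?R (z', t')) \<in> V" if z': "z' \<in> N1 \<inter> N2" and t': "t' \<in> J" for z' t'
      proof -
        have J: "t' \<in> {0..1}"
          using t' openin_subset[OF NJ(2)] by auto
        have near: "\<rho> z \<in> mspace m" "\<rho> z' \<in> mspace m" "mdist m (\<rho> z) (\<rho> z') < e / 2"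
          and pts: "z' \<in> teardrop_points W Y"
          using z' by (auto simp: N1_def topT)
        show ?thesis
        proof (cases "\<exists>x. z' = Inl x \<and> t' < 1")
          case True
          then obtain x where x: "z' = Inl x" "t' < 1" by auto
          then have xW: "x \<in> topspace W" using pts by (auto simp: teardrop_points_def)
          have tJ: "t' \<in> {0..<1}" using J x by simp
          let ?h = "pushed_height p (x, t')" and ?b = "fst (p (g (x, t')))"
          have h: "?h > b + 1" "?h > 2 / e"
            using high[of x t'] z' t' x by (auto simp: K_def)
          have bm: "?b \<in> mspace m"
            using pY[OF gW[OF xW tJ]] by (simp add: Y_def)
          have \<rho>x: "\<rho> z' = fst (p x)"
            by (simp add: x \<rho>_def teardrop_collapse_def)
          have "mdist m ?b (fst (p x)) * (2 / e) \<le> mdist m ?b (fst (p x)) * ?h"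
            using h by (intro mult_left_mono) auto
          also have "\<dots> < 1"
            by (rule g_base[OF xW tJ])
          finally have "mdist m ?b (fst (p x)) < e / 2"
            using e by (simp add: field_simps)
          then have "mdist m (\<rho> z) ?b < e"
            using near mdist_triangle[of "\<rho> z" m "\<rho> z'" ?b] bm by (simp add: \<rho>x mdist_commute)
          then have "?b \<in> V1"
            using e near bm by auto
          moreover have "ereal (snd (p (g (x, t')))) \<in> V2"
            using g_height[OF xW tJ] h by (intro b) linarith
          ultimately show ?thesis
            using V12(5) x by (auto simp: teardrop_collapse_def)
        next
          case False
          then have "teardrop_collapse p (?R (z', t')) = (\<rho> z', \<infinity>)"
            by (auto simp: \<rho>_def teardrop_collapse_def split: sum.split)
          moreover have "\<rho> z' \<in> V1"
            using near e by auto
          ultimately show ?thesis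
            using V12(4,5) by auto
        qed
      qed
      then have "(N1 \<inter> N2) \<times> J \<subseteq> ?P"
        using openin_subset[OF N1] openin_subset[OF NJ(2)] by fastforce
      moreover have "openin ?TI ((N1 \<inter> N2) \<times> J)"
        using N1 NJ by (simp add: openin_prod_Times_iff openin_Int)
      ultimately show ?thesis
        using zN1 NJ zt by blast
    qed
  qed
qed

section \<open>Deformation retraction of approximate tubular neighborhoods\<close>

theorem corollary6p2:
  fixes X :: "'a topology" and F :: "int \<Rightarrow> 'a set" and Y N :: "'a set"
  assumes "MHSS X F"
    and "pure_subset X F Y"
    and "approximate_tubular_neighborhood X F Y N"
  shows "NSDRN X F Y N"
proof -
  let ?W = "subtopology X (N - Y)" and ?Y = "subtopology X Y" and ?N = "subtopology X N"
  obtain p where nbhd: "neighborhood X N Y"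
    and msaf: "MSAF ?W (restrict_filtration F (N - Y)) (prod_topology ?Y euclideanreal)
      (times_real_filtration (restrict_filtration F Y)) p"
    and k: "homeomorphic_map (teardrop ?W ?Y p) ?N (case_sum (\<lambda>x. x) (\<lambda>y. y))"
    using assms(3) unfolding approximate_tubular_neighborhood_def by metis
  have sub: "Y \<subseteq> N" "N \<subseteq> topspace X"
    using nbhd by (auto simp: neighborhood_def)
  then have top: "topspace ?Y = Y" "topspace ?W = N - Y" "topspace ?N = N"
    by auto
  have "metrizable_space X"
    using assms(1) by (simp add: MHSS_def)
  then obtain m where m: "?Y = mtopology_of m"
    using metrizable_space_as_metric metrizable_space_subtopology by metis
  have p: "continuous_map ?W (prod_topology ?Y euclideanreal) p"
    using msaf by (simp add: MSAF_def)
  have pY: "fst (p x) \<in> Y" if "x \<in> N - Y" for x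
    using continuous_map_image_subset_topspace[OF p] that top by fastforce
  obtain g where g: "continuous_map (prod_topology ?W (top_of_set {0..<1})) ?W g"
    and g0: "\<And>x. x \<in> topspace ?W \<Longrightarrow> g (x, 0) = x"
    and g_strat: "\<And>x. x \<in> topspace ?W \<Longrightarrow>
      \<exists>i. \<forall>t\<in>{0..<1}. g (x, t) \<in> stratum (restrict_filtration F (N - Y)) i"
    and g_near: "\<And>x t. x \<in> topspace ?W \<Longrightarrow> t \<in> {0..<1} \<Longrightarrow>
       \<bar>snd (p (g (x, t))) - pushed_height p (x, t)\<bar> < 1"
      "\<And>x t. x \<in> topspace ?W \<Longrightarrow> t \<in> {0..<1} \<Longrightarrow>
       mdist m (fst (p (g (x, t)))) (fst (p x)) * pushed_height p (x, t) < 1"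
    using MSAF_controlled_push[OF msaf[unfolded m]] by metis
  let ?R = "\<lambda>(z, t). case z of Inl x \<Rightarrow> if t < 1 then Inl (g (x, t)) else Inr (fst (p x)) | Inr y \<Rightarrow> Inr y"
  have R: "continuous_map (prod_topology (teardrop ?W ?Y p) unit_interval) (teardrop ?W ?Y p) ?R"
    using continuous_map_push_teardrop[OF p[unfolded m] g g_near] by (simp add: m)
  \<comment> \<open>The inverse of the natural identification of the teardrop with \<open>N\<close>, written out.\<close>
  define k' where "k' x = (if x \<in> Y then Inr x else Inl x)" for x
  obtain k0 where k0: "homeomorphic_maps (teardrop ?W ?Y p) ?N (case_sum (\<lambda>x. x) (\<lambda>y. y)) k0"
    using k homeomorphic_map_maps by blast
  have "k' x \<in> topspace (teardrop ?W ?Y p)" if "x \<in> N" for x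
    using teardrop_admissible_teardrop[OF p] that top
    by (auto simp: teardrop_admissible_def teardrop_points_def k'_def)
  then have "k0 x = k' x" if "x \<in> N" for x
    using k0 that unfolding homeomorphic_maps_def by (force simp: k'_def split: if_splits)
  then have kk: "continuous_map (teardrop ?W ?Y p) ?N (case_sum (\<lambda>x. x) (\<lambda>y. y))"
    "continuous_map ?N (teardrop ?W ?Y p) k'"
    using k0 continuous_map_eq[of ?N _ k0 k'] top by (auto simp: homeomorphic_maps_def)
  define r where "r = (\<lambda>(x, t). if x \<in> Y then x else if t < 1 then g (x, t) else fst (p x))"
  have "continuous_map (prod_topology ?N unit_interval) (prod_topology (teardrop ?W ?Y p) unit_interval)
      (\<lambda>(x, t). (k' x, t))"
    using kk by (simp add: continuous_map_prod_top)
  from continuous_map_compose[OF this continuous_map_compose[OF R kk(1)]]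
  have "continuous_map (prod_topology ?N unit_interval) ?N r"
    by (rule back_subst[where P="continuous_map _ _"]) (auto simp: r_def k'_def)
  moreover have "stratum_preserving_along (restrict_filtration F N) N {0..<1} r"
    unfolding stratum_preserving_along_def
  proof
    fix x assume x: "x \<in> N"
    show "\<exists>i. r ` ({x} \<times> {0..<1}) \<subseteq> stratum (restrict_filtration F N) i"
    proof (cases "x \<in> Y")
      case True
      have "filtered_space X F" "x \<in> topspace X"
        using assms(1) sub x by (auto simp: MHSS_def)
      then obtain i where "x \<in> stratum F i"
        by (rule filtered_space_stratum_exists)
      with True x show ?thesis
        by (auto simp: r_def stratum_restrict_filtration)
    next
      case False
      with x g_strat[of x] top show ?thesis
        by (fastforce simp: r_def stratum_restrict_filtration)
    qed
  qed
  moreover have "r (x, 0) = x" if "x \<in> N" for x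
    using that g0 top by (auto simp: r_def)
  moreover have "(\<lambda>x. r (x, 1)) ` N = Y"
    using sub pY by (force simp: r_def image_iff)
  moreover have "r (y, t) = y" if "y \<in> Y" for y t
    using that by (simp add: r_def)
  ultimately show ?thesis
    using nbhd unfolding NSDRN_def by blast
qed

end
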